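(* Let $p,r\ge 0$ and $q\ge 2$ be integers with $p,r$ not both zero, and let $\Gamma\simeq \mathcal{C}_{p,q,r}$. If $r=0$ (equivalently, if $p=0$), then $\beta(\Gamma)=2$.
   Context: For a connected graph $\Gamma$ with vertex set $V(\Gamma)$, $d(u,v)$ is the length (number of edges) of a shortest path between $u$ and $v$. For an ordered set $R=\{w_1,\dots,w_t\}\subseteq V(\Gamma)$, the representation of a vertex $v$ with respect to $R$ is $(d(v,w_1),\dots,d(v,w_t))$. $R$ is a resolving set if distinct vertices have distinct representations with respect to $R$. The metric dimension $\beta(\Gamma)$ is the minimum cardinality of a resolving set of $\Gamma$. The graph $\mathcal{C}_{p,q,r}$ (base bicyclic graph of type III) is defined for integers $p,r\ge 0$ and $q\ge 2$, with $p,r$ not both zero, as follows. Take three disjoint paths $\mathcal{P}_1=v_1\cdots v_p$, $\mathcal{P}_2=v_{p+1}\cdots v_{p+q}$ and $\mathcal{P}_3=v_{p+q+1}\cdots v_{p+q+r}$ having $p$, $q$ and $r$ vertices respectively; join the starting vertices of $\mathcal{P}_1$ and $\mathcal{P}_3$ to the starting vertex $v_{p+1}$ of $\mathcal{P}_2$, and join the ending vertices of $\mathcal{P}_1$ and $\mathcal{P}_3$ to the ending vertex $v_{p+q}$ of $\mathcal{P}_2$ (a one-vertex path has its starting vertex equal to its ending vertex). If one of $\mathcal{P}_1$, $\mathcal{P}_3$ has no vertices, it is replaced by an edge joining $v_{p+1}$ and $v_{p+q}$; if this edge coincides with an edge of $\mathcal{P}_2$ (which happens for $q=2$), it is counted only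 once. Thus $v_{p+1}$ and $v_{p+q}$ are joined by three internally disjoint paths of lengths $p+1$, $q-1$, $r+1$. Interchanging $p$ and $r$ gives an isomorphic graph: $\mathcal{C}_{p,q,r}\simeq\mathcal{C}_{r,q,p}$. *)

theory Defs
  imports "Graph_Theory.Graph_Theory"
begin

text \<open>
  An undirected simple graph is a symmetric digraph without loops or parallel arcs, i.e. an
  instance of the locale \<^locale>\<open>graph\<close>; each edge is a pair of opposite arcs.
\<close>

text \<open>
  Intended for connected graphs only: for unreachable \<open>v\<close> the \<open>LEAST\<close> below is unspecified.
\<close>

definition graph_dist :: "('a,'b) pre_digraph \<Rightarrow> 'a \<Rightarrow> 'a \<Rightarrow> nat" where
  "graph_dist G u v = (LEAST n. \<exists>p. pre_digraph.apath G u p v \<and> length p = n)"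

definition representation :: "('a,'b) pre_digraph \<Rightarrow> 'a list \<Rightarrow> 'a \<Rightarrow> nat list" where
  "representation G R v = map (graph_dist G v) R"

text \<open>Ordered subsets of the vertex set are lists without repetitions.\<close>

definition resolving_set :: "('a,'b) pre_digraph \<Rightarrow> 'a list \<Rightarrow> bool" where
  "resolving_set G R \<longleftrightarrow> distinct R \<and> set R \<subseteq> verts G \<and>
     (\<forall>u\<in>verts G. \<forall>v\<in>verts G. u \<noteq> v \<longrightarrow> representation G R u \<noteq> representation G R v)"

definition metric_dimension :: "('a,'b) pre_digraph \<Rightarrow> nat" where
  "metric_dimension G = (LEAST k. \<exists>R. resolving_set G R \<and> length R = k)"

text \<open>
  The vertex \<open>v\<^sub>i\<close> is the number \<open>i\<close>. In \<^term>\<open>path_edges a b\<close> the path runs through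
  \<open>a, a + 1, \<dots>, b\<close>; it has no edges if \<open>b \<le> a\<close>. In \<open>attach\<close>, the path \<open>a, \<dots>, b\<close> is joined
  to the vertices \<open>s\<close> and \<open>t\<close>; \<open>b < a\<close> encodes the path without vertices, which is replaced
  by the edge between \<open>s\<close> and \<open>t\<close>.
\<close>

definition path_edges :: "nat \<Rightarrow> nat \<Rightarrow> nat rel" where
  "path_edges a b = {(i, i + 1) | i. a \<le> i \<and> i < b}"

definition attach :: "nat \<Rightarrow> nat \<Rightarrow> nat \<Rightarrow> nat \<Rightarrow> nat rel" where
  "attach s t a b = (if b < a then {(s, t)} else path_edges a b \<union> {(a, s), (b, t)})"

definition bicyclic_III_edges :: "nat \<Rightarrow> nat \<Rightarrow> nat \<Rightarrow> nat rel" where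
  "bicyclic_III_edges p q r =
     path_edges (p + 1) (p + q)
     \<union> attach (p + 1) (p + q) 1 p
     \<union> attach (p + 1) (p + q) (p + q + 1) (p + q + r)"

definition bicyclic_III :: "nat \<Rightarrow> nat \<Rightarrow> nat \<Rightarrow> nat pair_pre_digraph" where
  "bicyclic_III p q r =
     \<lparr> pverts = {1..p + q + r},
       parcs = bicyclic_III_edges p q r \<union> (bicyclic_III_edges p q r)\<inverse> \<rparr>"

lemma graph_bicyclic_III:
  assumes "q \<ge> 2"
  shows "graph (with_proj (bicyclic_III p q r))"
proof -
  have sub: "bicyclic_III_edges p q r \<subseteq> {1..p + q + r} \<times> {1..p + q + r}"
    and irr: "\<And>u. (u, u) \<notin> bicyclic_III_edges p q r"
    using assms
    by (auto simp: bicyclic_III_edges_def attach_def path_edges_def split: if_splits)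
  have fin: "finite (bicyclic_III_edges p q r)"
    by (rule finite_subset[OF sub]) simp
  interpret pair_graph "bicyclic_III p q r"
    using sub irr fin
    by unfold_locales
       (auto simp: bicyclic_III_def symmetric_def arcs_ends_conv intro!: symI)
  show ?thesis by unfold_locales
qed

end

theory Submission
  imports Defs
begin

text \<open>
  Every vertex has two neighbours, which are at equal distance from it, so one landmark never
  suffices. For two landmarks, note that the graph is a cycle with the chord between
  \<open>v\<^bsub>p+1\<^esub>\<close> and \<open>v\<^bsub>p+q\<^esub>\<close>, so the nonempty one of the paths \<open>P\<^sub>1\<close>, \<open>P\<^sub>3\<close> closes
  with the chord to a cycle of length at least three. On that cycle take the two ends of an edge
  which is (nearly) antipodal to the chord. Being adjacent, they resolve this cycle. A vertex on
  the other side is reached through the chord's ends, and its two distances determine those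
  to the ends of the chord, hence the vertex; they are too large to occur on the first cycle.
\<close>

section \<open>Distances and metric dimension\<close>

context wf_digraph
begin

section \<open>Invariance under isomorphism\<close>

lemma apath_app_isoI:
  assumes "apath u p v" and hom: "digraph_isomorphism h"
  shows "pre_digraph.apath (app_iso h G) (iso_verts h u) (map (iso_arcs h) p) (iso_verts h v)"
proof -
  have w: "awalk u p v" and d: "distinct (awalk_verts u p)"
    using assms(1) by (auto simp: apath_def)
  have "set (awalk_verts u p) \<subseteq> verts G" using w unfolding awalk_conv by blast
  then have "inj_on (iso_verts h) (set (awalk_verts u p))"
    by (rule inj_on_subset[OF digraph_isomorphism_inj_on_verts[OF hom]])
  then show ?thesis
    using awalk_app_isoI[OF w hom] awalk_verts_app_iso_eq[OF hom w] d
    by (simp add: pre_digraph.apath_def distinct_map)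
qed

text \<open>Simple paths are transported along \<open>h\<close> and back along its inverse, with the
  same length, so both minima range over the same set.\<close>

lemma graph_dist_app_iso:
  assumes hom: "digraph_isomorphism h" and u: "u \<in> verts G" and v: "v \<in> verts G"
  shows "graph_dist (app_iso h G) (iso_verts h u) (iso_verts h v) = graph_dist G u v"
proof -
  interpret H: wf_digraph "app_iso h G" using hom ..
  have "(\<exists>p. H.apath (iso_verts h u) p (iso_verts h v) \<and> length p = n) \<longleftrightarrow>
        (\<exists>p. apath u p v \<and> length p = n)" for n
  proof
    assume "\<exists>p. H.apath (iso_verts h u) p (iso_verts h v) \<and> length p = n"
    then obtain p where "H.apath (iso_verts h u) p (iso_verts h v)" "length p = n" by auto
    then show "\<exists>p. apath u p v \<and> length p = n"
      using H.apath_app_isoI[OF _ digraph_isomorphism_invI[OF hom]] hom u v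
      by (metis (no_types, lifting) app_iso_inv iso_verts_inv_iso length_map)
  next
    assume "\<exists>p. apath u p v \<and> length p = n"
    then show "\<exists>p. H.apath (iso_verts h u) p (iso_verts h v) \<and> length p = n"
      using apath_app_isoI[OF _ hom] by (metis length_map)
  qed
  then show ?thesis by (simp add: graph_dist_def)
qed

lemma resolving_set_app_iso:
  assumes hom: "digraph_isomorphism h" and R: "set R \<subseteq> verts G"
  shows "resolving_set (app_iso h G) (map (iso_verts h) R) \<longleftrightarrow> resolving_set G R"
proof -
  have inj: "inj_on (iso_verts h) (verts G)"
    using hom by (rule digraph_isomorphism_inj_on_verts)
  have "representation (app_iso h G) (map (iso_verts h) R) (iso_verts h u) = representation G R u"
    if "u \<in> verts G" for u
    using that R by (auto simp: representation_def graph_dist_app_iso[OF hom])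
  then show ?thesis
    using R inj inj_on_subset[OF inj R]
    by (auto simp: resolving_set_def distinct_map inj_on_eq_iff)
qed

lemma metric_dimension_app_iso:
  assumes hom: "digraph_isomorphism h"
  shows "metric_dimension (app_iso h G) = metric_dimension G"
proof -
  have "(\<exists>R. resolving_set (app_iso h G) R \<and> length R = k) \<longleftrightarrow>
        (\<exists>R. resolving_set G R \<and> length R = k)" for k
  proof
    assume "\<exists>R. resolving_set (app_iso h G) R \<and> length R = k"
    then obtain R where R: "resolving_set (app_iso h G) R" "length R = k" by auto
    \<comment> \<open>A list over an image is the image of a list, so \<open>R\<close> can be pulled
      back.\<close>
    then have "R \<in> lists (iso_verts h ` verts G)"
      by (auto simp: resolving_set_def)
    then obtain R' where "R = map (iso_verts h) R'" "set R' \<subseteq> verts G"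
      unfolding lists_image by auto
    with R show "\<exists>R. resolving_set G R \<and> length R = k"
      using resolving_set_app_iso[OF hom] by (metis length_map)
  next
    assume "\<exists>R. resolving_set G R \<and> length R = k"
    then show "\<exists>R. resolving_set (app_iso h G) R \<and> length R = k"
      using resolving_set_app_iso[OF hom] by (metis length_map resolving_set_def)
  qed
  then show ?thesis by (simp add: metric_dimension_def)
qed

section \<open>Recognising distances and metric dimension two\<close>

text \<open>A potential that drops by at most one along an arc bounds walk lengths from below;
  descending it step by step reaches \<open>w\<close> in exactly \<open>f u\<close> steps. This
  reduces distances to local checks.\<close>

lemma graph_dist_eqI:
  assumes w: "w \<in> verts G" "f w = 0"
    and lipschitz: "\<And>u v. u \<rightarrow>\<^bsub>G\<^esub> v \<Longrightarrow> f u \<le> f v + 1"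
    and descent: "\<And>u. u \<in> verts G \<Longrightarrow> u \<noteq> w \<Longrightarrow> \<exists>v. u \<rightarrow>\<^bsub>G\<^esub> v \<and> f u = Suc (f v)"
    and u: "u \<in> verts G"
  shows "graph_dist G u w = f u"
proof -
  have lower: "f u \<le> length p" if "awalk u p w" for u p
    using that
  proof (induction p arbitrary: u)
    case Nil
    then show ?case using w by (simp add: awalk_simps)
  next
    case (Cons e p)
    then have "f (head G e) \<le> length p" "e \<in> arcs G" "u = tail G e"
      by (auto simp: awalk_simps)
    moreover from this have "u \<rightarrow>\<^bsub>G\<^esub> head G e" by (auto simp: arcs_ends_conv)
    ultimately show ?case using lipschitz by force
  qed
  \<comment> \<open>The bound on \<open>f\<close> along the path is carried so that a prepended
    vertex, having a larger value, is new and the path stays simple.\<close>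
  have "\<exists>p. apath u p w \<and> length p = f u \<and> (\<forall>x \<in> set (awalk_verts u p). f x \<le> f u)"
    using u
  proof (induction "f u" arbitrary: u)
    case 0
    then have "u = w" using descent by force
    then show ?case using w by (intro exI[of _ "[]"]) (auto simp: apath_Nil_iff)
  next
    case (Suc k)
    then have "u \<noteq> w" using w by auto
    then obtain v where v: "u \<rightarrow>\<^bsub>G\<^esub> v" "f u = Suc (f v)" using descent Suc.prems by blast
    then obtain e where e: "e \<in> arcs G" "u = tail G e" "v = head G e"
      by (auto simp: arcs_ends_conv)
    obtain p where p: "apath v p w" "length p = f v" "\<forall>x \<in> set (awalk_verts v p). f x \<le> f v"
      using Suc v adj_in_verts by (metis Suc_inject)
    have "u \<notin> set (awalk_verts v p)" using p v by force
    then have "apath u (e # p) w" using p e by (auto simp: apath_Cons_iff)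
    then show ?case using p v e by (intro exI[of _ "e # p"]) (auto simp: le_SucI)
  qed
  then obtain p where "apath u p w" "length p = f u" by blast
  then show ?thesis
    unfolding graph_dist_def using lower
    by (intro Least_equality) (auto simp: apath_def)
qed

end

lemma (in loopfree_digraph) graph_dist_neighbour:
  assumes "u \<rightarrow>\<^bsub>G\<^esub> w"
  shows "graph_dist G u w = 1"
proof -
  obtain e where e: "e \<in> arcs G" "u = tail G e" "w = head G e"
    using assms by (auto simp: arcs_ends_conv)
  then have ne: "u \<noteq> w" using no_loops by auto
  show ?thesis
    unfolding graph_dist_def
  proof (rule Least_equality)
    show "\<exists>p. apath u p w \<and> length p = 1"
      using e ne by (intro exI[of _ "[e]"]) (auto simp: apath_simps)
  next
    fix n assume "\<exists>p. apath u p w \<and> length p = n"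
    then show "1 \<le> n" using ne by (cases n) (auto simp: apath_simps)
  qed
qed

lemma (in loopfree_digraph) metric_dimension_eq_2I:
  assumes res: "resolving_set G [w1, w2]"
    and deg: "\<And>w. w \<in> verts G \<Longrightarrow> \<exists>u v. u \<noteq> v \<and> u \<rightarrow>\<^bsub>G\<^esub> w \<and> v \<rightarrow>\<^bsub>G\<^esub> w"
  shows "metric_dimension G = 2"
  unfolding metric_dimension_def
proof (rule Least_equality)
  show "\<exists>R. resolving_set G R \<and> length R = 2"
    using res by (intro exI[of _ "[w1, w2]"]) simp
next
  fix k assume "\<exists>R. resolving_set G R \<and> length R = k"
  then obtain R where R: "resolving_set G R" "length R = k" by auto
  show "2 \<le> k"
  proof (rule ccontr)
    assume "\<not> 2 \<le> k"
    then have "R = [] \<or> (\<exists>w. R = [w])" using R by (cases R; cases "tl R") auto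
    \<comment> \<open>For \<open>R = []\<close> any vertex serves as \<open>w\<close>, and
      \<open>w1\<close> shows that there is one.\<close>
    then obtain w where w: "w \<in> verts G" "set R \<subseteq> {w}"
      using R res by (auto simp: resolving_set_def)
    obtain u v where uv: "u \<noteq> v" "u \<rightarrow>\<^bsub>G\<^esub> w" "v \<rightarrow>\<^bsub>G\<^esub> w" using deg w by blast
    then have "representation G R u = representation G R v"
      using w graph_dist_neighbour by (auto simp: representation_def)
    moreover have "u \<in> verts G" "v \<in> verts G" using uv adj_in_verts by auto
    ultimately show False using R uv by (auto simp: resolving_set_def)
  qed
qed


section \<open>Cycles with a chord\<close>

text \<open>
  The vertices \<open>s + 1, \<dots>, s + n\<close> form the path attached to the ends \<open>m\<close> and \<open>m + q - 1\<close> of the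
  path \<open>m, \<dots>, m + q - 1\<close>; the two alternatives for \<open>s\<close> and \<open>m\<close> are \<open>r = 0\<close> and \<open>p = 0\<close>.
\<close>

locale chorded_cycle =
  fixes n q s m :: nat and E :: "nat rel"
  assumes n: "1 \<le> n" and q: "2 \<le> q"
    and position: "s = 0 \<and> m = n + 1 \<or> s = q \<and> m = 1"
    and E: "E = path_edges m (m + q - 1) \<union> {(m, m + q - 1)} \<union> path_edges (s + 1) (s + n)
       \<union> {(s + 1, m), (s + n, m + q - 1)}"
begin

abbreviation G :: "nat pair_pre_digraph" where
  "G \<equiv> \<lparr> pverts = {1..n + q}, parcs = E \<union> E\<inverse> \<rparr>"

text \<open>\<open>c\<close> and \<open>e\<close> count the vertices of the attached path before and
  after \<open>w2\<close>.\<close>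

definition c :: nat where "c = n div 2"

definition e :: nat where "e = (n - 1) div 2"

text \<open>For \<open>n = 1\<close> the attached path has no vertex before \<open>w2\<close>, and
  \<open>m\<close> takes that place.\<close>

definition w1 :: nat where "w1 = (if c = 0 then m else s + c)"

definition w2 :: nat where "w2 = s + (c + 1)"

text \<open>
  \<open>f1\<close> and \<open>f2\<close> are the distances to \<open>w1\<close> and \<open>w2\<close>. A sum of opposite truncated differences
  is an absolute difference. A shortest path from \<open>m + j\<close> leaves the \<open>q\<close>-cycle at \<open>m\<close> or at \<open>m + q - 1\<close>;
  for \<open>w1\<close>, going through \<open>m\<close> is always optimal.
\<close>

definition f1 :: "nat \<Rightarrow> nat" where
  "f1 v = (if s < v \<and> v \<le> s + n then (s + c - v) + (v - (s + c))
           else c + min (v - m) (m + q - v))"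

definition f2 :: "nat \<Rightarrow> nat" where
  "f2 v = (if s < v \<and> v \<le> s + n then (s + (c + 1) - v) + (v - (s + (c + 1)))
           else min (c + 1 + (v - m)) (e + (m + q - v)))"

section \<open>Coordinates and edges\<close>

lemma n_eq: "n = c + e + 1" "e \<le> c" "c \<le> e + 1"
  using n unfolding c_def e_def by presburger+

text \<open>The offsets \<open>i\<close>, from 1, and \<open>j\<close>, from 0, let most later
  arguments treat both alternatives for \<open>s\<close> and \<open>m\<close> at once.\<close>

lemma offset_cases:
  assumes "v \<in> {1..n + q}"
  obtains (inner) i where "1 \<le> i" "i \<le> n" "v = s + i" | (outer) j where "j < q" "v = m + j"
proof (cases "s < v \<and> v \<le> s + n")
  case True
  then show ?thesis by (intro inner[of "v - s"]) auto
next
  case False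
  then show ?thesis using assms position by (intro outer[of "v - m"]) auto
qed

lemma f_inner:
  assumes "1 \<le> i" "i \<le> n"
  shows "f1 (s + i) = (c - i) + (i - c)"
    and "f2 (s + i) = (c + 1 - i) + (i - (c + 1))"
  using assms by (auto simp: f1_def f2_def)

lemma f_outer:
  assumes "j < q"
  shows "f1 (m + j) = c + min j (q - j)"
    and "f2 (m + j) = min (c + 1 + j) (e + (q - j))"
  using assms position by (auto simp: f1_def f2_def)

text \<open>The ends are written \<open>m + 0\<close> and \<open>m + (q - 1)\<close> so that
  instances of \<open>f_outer\<close> rewrite them directly.\<close>

lemma E_cases:
  assumes "(u, v) \<in> E"
  obtains (outer) j where "j + 1 < q" "u = m + j" "v = m + (j + 1)"
  | (chord) "u = m + 0" "v = m + (q - 1)"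
  | (inner) i where "1 \<le> i" "i < n" "u = s + i" "v = s + (i + 1)"
  | (start) "u = s + 1" "v = m + 0"
  | (finish) "u = s + n" "v = m + (q - 1)"
proof -
  have "(\<exists>j. j + 1 < q \<and> u = m + j \<and> v = m + (j + 1)) \<or> (u = m \<and> v = m + (q - 1)) \<or>
      (\<exists>i. 1 \<le> i \<and> i < n \<and> u = s + i \<and> v = s + (i + 1)) \<or>
      (u = s + 1 \<and> v = m) \<or> (u = s + n \<and> v = m + (q - 1))"
    using assms q unfolding E path_edges_def
    by (auto dest!: le_Suc_ex simp: Suc_le_eq dest!: less_imp_Suc_add)
  then show thesis using that by fastforce
qed

lemma E_intros:
  "j + 1 < q \<Longrightarrow> (m + j, m + (j + 1)) \<in> E"
  "1 \<le> i \<Longrightarrow> i < n \<Longrightarrow> (s + i, s + (i + 1)) \<in> E"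
  "(s + 1, m + 0) \<in> E"
  "(s + n, m + (q - 1)) \<in> E"
  using q by (auto simp: E path_edges_def)

section \<open>Local conditions for the two distance functions\<close>

lemma f_lipschitz:
  assumes "(u, v) \<in> E"
  shows "f1 u \<le> f1 v + 1 \<and> f1 v \<le> f1 u + 1 \<and> f2 u \<le> f2 v + 1 \<and> f2 v \<le> f2 u + 1"
  using assms
proof (cases rule: E_cases)
  case (outer j)
  \<comment> \<open>This substitution removes the truncated subtractions.\<close>
  obtain d where "q = j + 2 + d"
    using le_Suc_ex[of "j + 2" q] outer(1) by auto
  then have "q - j = d + 2" "q - (j + 1) = d + 1" "j < q" by auto
  then show ?thesis
    unfolding outer f_outer[OF \<open>j < q\<close>] f_outer[OF outer(1)]
    by (intro conjI; simp)
next
  case chord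
  \<comment> \<open>Across the chord \<open>f1\<close> takes the values \<open>c\<close>,
    \<open>c + 1\<close> and \<open>f2\<close> the values \<open>c + 1\<close>,
    \<open>e + 1\<close>; the latter differ by at most one since
    \<open>e \<le> c \<le> e + 1\<close>.\<close>
  have "0 < q" "q - 1 < q" using q by auto
  show ?thesis
    unfolding chord f_outer[OF \<open>0 < q\<close>] f_outer[OF \<open>q - 1 < q\<close>]
    using q n_eq by linarith
next
  case (inner i)
  have "i \<le> n" "1 \<le> i + 1" "i + 1 \<le> n" using inner by auto
  then show ?thesis
    unfolding inner f_inner[OF inner(1) \<open>i \<le> n\<close>] f_inner[OF \<open>1 \<le> i + 1\<close> \<open>i + 1 \<le> n\<close>]
    by auto
next
  case start
  have "0 < q" "1 \<le> (1::nat)" using q by auto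
  show ?thesis
    unfolding start f_outer[OF \<open>0 < q\<close>] f_inner[OF \<open>1 \<le> 1\<close> n]
    using q n_eq by (intro conjI) linarith+
next
  case finish
  have "q - 1 < q" "q - (q - 1) = 1" "n \<le> n" using q by auto
  have "f1 v = c + 1" "f2 v = e + 1"
    unfolding finish f_outer[OF \<open>q - 1 < q\<close>] \<open>q - (q - 1) = 1\<close> using q n_eq by auto
  moreover have "f1 u = e + 1" "f2 u = e"
    unfolding finish f_inner[OF n \<open>n \<le> n\<close>] using n_eq by auto
  ultimately show ?thesis using n_eq by simp
qed

text \<open>With the next lemma, this gives the predecessor and successor on the Hamiltonian cycle
  formed by the two paths.\<close>

lemma inner_neighbours:
  assumes "1 \<le> i" "i \<le> n"
  shows "(s + i, if i = 1 then m + 0 else s + (i - 1)) \<in> E \<union> E\<inverse>"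
    and "(s + i, if i = n then m + (q - 1) else s + (i + 1)) \<in> E \<union> E\<inverse>"
  using assms E_intros(2)[of "i - 1"] E_intros(2)[of i] E_intros(3,4) by auto

lemma outer_neighbours:
  assumes "j < q"
  shows "(m + j, if j = 0 then s + 1 else m + (j - 1)) \<in> E \<union> E\<inverse>"
    and "(m + j, if j = q - 1 then s + n else m + (j + 1)) \<in> E \<union> E\<inverse>"
  using assms E_intros(1)[of "j - 1"] E_intros(1)[of j] E_intros(3,4) by auto

text \<open>The Hamiltonian cycle has length \<open>n + q \<ge> 3\<close>, so the two neighbours on
  it differ.\<close>

lemma two_neighbours:
  assumes "w \<in> {1..n + q}"
  shows "\<exists>u v. u \<noteq> v \<and> (w, u) \<in> E \<union> E\<inverse> \<and> (w, v) \<in> E \<union> E\<inverse>"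
  using assms
proof (cases rule: offset_cases)
  case (inner i)
  then have "(if i = 1 then m + 0 else s + (i - 1)) \<noteq> (if i = n then m + (q - 1) else s + (i + 1))"
    using q position by auto
  then show ?thesis using inner_neighbours[of i] inner by blast
next
  case (outer j)
  then have "(if j = 0 then s + 1 else m + (j - 1)) \<noteq> (if j = q - 1 then s + n else m + (j + 1))"
    using q n position by auto
  then show ?thesis using outer_neighbours[of j] outer by blast
qed

lemma f1_descent:
  assumes "u \<in> {1..n + q}" "u \<noteq> w1"
  shows "\<exists>v. (u, v) \<in> E \<union> E\<inverse> \<and> f1 u = Suc (f1 v)"
  using assms(1)
proof (cases rule: offset_cases)
  case (inner i)
  then have "i \<noteq> c" using assms(2) by (auto simp: w1_def split: if_splits)
  then consider "i < c" | "i > c" "i = 1" | "i > c" "i > 1" using inner by linarith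
  then show ?thesis
  proof cases
    case 1
    then have "f1 (s + i) = Suc (f1 (s + (i + 1)))"
      using inner n_eq f_inner(1)[of i] f_inner(1)[of "i + 1"] by linarith
    then show ?thesis using E_intros(2)[of i] 1 inner n_eq by fastforce
  next
    case 2
    \<comment> \<open>Here \<open>c = 0\<close>, so \<open>w1\<close> is \<open>m\<close>
      itself.\<close>
    then have "f1 (s + i) = Suc (f1 (m + 0))"
      using inner n_eq f_inner(1)[of i] f_outer(1)[of 0] q by linarith
    then show ?thesis using E_intros(3) 2 inner by blast
  next
    case 3
    then have "f1 (s + i) = Suc (f1 (s + (i - 1)))"
      using inner n_eq f_inner(1)[of i] f_inner(1)[of "i - 1"] by linarith
    then show ?thesis using inner_neighbours(1)[of i] 3 inner by auto
  qed
next
  case (outer j)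
  \<comment> \<open>\<open>j\<close> and \<open>q - j\<close> are the lengths of the two ways to
    \<open>m\<close>: back along the path, or forward and over the chord.\<close>
  consider "j = 0" | "0 < j" "j \<le> q - j" | "q - j < j" "j = q - 1" | "q - j < j" "j + 1 < q"
    using outer by linarith
  then show ?thesis
  proof cases
    case 1
    then have "c \<noteq> 0" using assms(2) outer by (auto simp: w1_def split: if_splits)
    then have "f1 (m + j) = Suc (f1 (s + 1))"
      using 1 outer n n_eq f_inner(1)[of 1] f_outer(1)[of j] by linarith
    then show ?thesis using E_intros(3) 1 outer by blast
  next
    case 2
    then have "f1 (m + j) = Suc (f1 (m + (j - 1)))"
      using outer f_outer(1)[of j] f_outer(1)[of "j - 1"] by linarith
    then show ?thesis using outer_neighbours(1)[of j] 2 outer by auto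
  next
    case 3
    then have "f1 (m + j) = Suc (f1 (m + 0))"
      using outer f_outer(1)[of j] f_outer(1)[of 0] by linarith
    moreover have "(m + j, m + 0) \<in> E \<union> E\<inverse>" using 3 q by (auto simp: E)
    ultimately show ?thesis using outer by blast
  next
    case 4
    then have "f1 (m + j) = Suc (f1 (m + (j + 1)))"
      using outer f_outer(1)[of j] f_outer(1)[of "j + 1"] by linarith
    then show ?thesis using E_intros(1)[of j] 4 outer by blast
  qed
qed

lemma f2_descent:
  assumes "u \<in> {1..n + q}" "u \<noteq> w2"
  shows "\<exists>v. (u, v) \<in> E \<union> E\<inverse> \<and> f2 u = Suc (f2 v)"
  using assms(1)
proof (cases rule: offset_cases)
  case (inner i)
  then have "i \<noteq> c + 1" using assms(2) by (auto simp: w2_def)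
  then consider "i < c + 1" | "i > c + 1" by linarith
  then show ?thesis
  proof cases
    case 1
    then have "f2 (s + i) = Suc (f2 (s + (i + 1)))"
      using inner n_eq f_inner(2)[of i] f_inner(2)[of "i + 1"] by linarith
    then show ?thesis using E_intros(2)[of i] 1 inner n_eq by fastforce
  next
    case 2
    then have "f2 (s + i) = Suc (f2 (s + (i - 1)))"
      using inner n_eq f_inner(2)[of i] f_inner(2)[of "i - 1"] by linarith
    then show ?thesis using inner_neighbours(1)[of i] 2 inner n_eq by auto
  qed
next
  case (outer j)
  \<comment> \<open>The two sums are the lengths of the ways to \<open>w2\<close> through
    \<open>m\<close> and through \<open>m + q - 1\<close>; ties go to \<open>m\<close>.\<close>
  consider "c + 1 + j \<le> e + (q - j)" "j = 0" | "c + 1 + j \<le> e + (q - j)" "j > 0"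
    | "e + (q - j) < c + 1 + j" "j = q - 1" | "e + (q - j) < c + 1 + j" "j + 1 < q"
    using outer by linarith
  then show ?thesis
  proof cases
    case 1
    then have "f2 (m + j) = Suc (f2 (s + 1))"
      using outer n n_eq f_inner(2)[of 1] f_outer(2)[of j] by linarith
    then show ?thesis using E_intros(3) 1 outer by blast
  next
    case 2
    then have "f2 (m + j) = Suc (f2 (m + (j - 1)))"
      using outer f_outer(2)[of j] f_outer(2)[of "j - 1"] by linarith
    then show ?thesis using outer_neighbours(1)[of j] 2 outer by auto
  next
    case 3
    then have "f2 (m + j) = Suc (f2 (s + n))"
      using outer n n_eq f_inner(2)[of n] f_outer(2)[of j] by linarith
    then show ?thesis using E_intros(4) 3 outer by blast
  next
    case 4
    then have "f2 (m + j) = Suc (f2 (m + (j + 1)))"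
      using outer f_outer(2)[of j] f_outer(2)[of "j + 1"] by linarith
    then show ?thesis using E_intros(1)[of j] 4 outer by blast
  qed
qed

section \<open>The two distances determine the vertex\<close>

lemma f_inj:
  assumes "u \<in> {1..n + q}" "v \<in> {1..n + q}" "f1 u = f1 v" "f2 u = f2 v"
  shows "u = v"
proof -
  \<comment> \<open>Outer vertices have \<open>f1\<close> at least \<open>c\<close> and
    \<open>f2\<close> at least \<open>e + 1\<close>. An inner vertex has \<open>f1\<close> below
    \<open>c\<close> if \<open>i \<le> c\<close>, and \<open>f2\<close> at most \<open>e\<close>
    otherwise.\<close>
  have cross: False
    if "1 \<le> i" "i \<le> n" "j < q" "f1 (s + i) = f1 (m + j)" "f2 (s + i) = f2 (m + j)" for i j
  proof (cases "i \<le> c")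
    case True
    then show False using f_inner(1)[OF that(1,2)] f_outer(1)[OF that(3)] that by linarith
  next
    case False
    then show False using f_inner(2)[OF that(1,2)] f_outer(2)[OF that(3)] that n_eq by linarith
  qed
  \<comment> \<open>Each distance fixes \<open>i\<close> up to a reflection, and the centres
    \<open>c\<close> and \<open>c + 1\<close> differ.\<close>
  have inner: "i = i'"
    if "1 \<le> i" "i \<le> n" "1 \<le> i'" "i' \<le> n" "f1 (s + i) = f1 (s + i')" "f2 (s + i) = f2 (s + i')"
    for i i'
    using f_inner[OF that(1,2)] f_inner[OF that(3,4)] that by linarith
  have outer: "j = j'"
    if "j < q" "j' < q" "f1 (m + j) = f1 (m + j')" "f2 (m + j) = f2 (m + j')" for j j'
  proof (rule ccontr)
    assume "j \<noteq> j'"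
    \<comment> \<open>\<open>f1\<close> fixes \<open>min j (q - j)\<close>, which leaves only the
      reflection. If \<open>j < j'\<close>, then \<open>f2 (m + j') = e + j\<close>, while
      \<open>f2 (m + j)\<close> is larger because \<open>e \<le> c\<close>.\<close>
    then have "j' = q - j" "j = q - j'"
      using f_outer(1)[OF that(1)] f_outer(1)[OF that(2)] that(1-3) by linarith+
    then show False
      using f_outer(2)[OF that(1)] f_outer(2)[OF that(2)] that(4) \<open>j \<noteq> j'\<close> n_eq(2,3)
      by simp
  qed
  show ?thesis
    using assms cross inner outer by (elim offset_cases) metis+
qed

lemma metric_dimension_G: "metric_dimension (with_proj G) = 2"
proof -
  have "E \<subseteq> {1..n + q} \<times> {1..n + q}" and "\<And>u. (u, u) \<notin> E"
    using n q position by (auto simp: E path_edges_def)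
  then interpret loopfree_digraph "with_proj G"
    by unfold_locales auto
  have w: "w1 \<in> {1..n + q}" "w2 \<in> {1..n + q}" "f1 w1 = 0" "f2 w2 = 0"
    using n_eq n q position by (auto simp: w1_def w2_def f1_def f2_def)
  have dist: "graph_dist (with_proj G) u w1 = f1 u" "graph_dist (with_proj G) u w2 = f2 u"
    if "u \<in> {1..n + q}" for u
    using w f_lipschitz f1_descent f2_descent that
    by (intro graph_dist_eqI; fastforce)+
  have "f1 w2 \<noteq> 0" using f_inner(1)[of "c + 1"] n_eq by (simp add: w2_def)
  then have "w1 \<noteq> w2" using w by auto
  then have "resolving_set (with_proj G) [w1, w2]"
    unfolding resolving_set_def
  proof (intro conjI ballI impI notI)
    fix u v
    assume uv: "u \<in> verts (with_proj G)" "v \<in> verts (with_proj G)" "u \<noteq> v"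
      and "representation (with_proj G) [w1, w2] u = representation (with_proj G) [w1, w2] v"
    then have "f1 u = f1 v" "f2 u = f2 v"
      using dist[of u] dist[of v] by (simp_all add: representation_def)
    then show False using f_inj[of u v] uv by simp
  qed (use w in auto)
  then show ?thesis
  proof (rule metric_dimension_eq_2I)
    fix w assume "w \<in> verts (with_proj G)"
    then have "w \<in> {1..n + q}" by simp
    then obtain u v where "u \<noteq> v" "(w, u) \<in> E \<union> E\<inverse>" "(w, v) \<in> E \<union> E\<inverse>"
      using two_neighbours by blast
    then show "\<exists>u v. u \<noteq> v \<and> u \<rightarrow>\<^bsub>with_proj G\<^esub> w \<and> v \<rightarrow>\<^bsub>with_proj G\<^esub> w"
      by (intro exI[of _ u] exI[of _ v]) auto
  qed
qed

end

section \<open>The bicyclic graphs\<close>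

lemma metric_dimension_bicyclic_III:
  assumes "q \<ge> 2" "\<not> (p = 0 \<and> r = 0)" "r = 0 \<or> p = 0"
  shows "metric_dimension (with_proj (bicyclic_III p q r)) = 2"
proof (cases "r = 0")
  case True
  interpret chorded_cycle p q 0 "p + 1" "bicyclic_III_edges p q r"
    using assms True
    by unfold_locales (auto simp: bicyclic_III_edges_def attach_def)
  show ?thesis using metric_dimension_G True by (simp add: bicyclic_III_def)
next
  case False
  interpret chorded_cycle r q q 1 "bicyclic_III_edges p q r"
    using assms False
    by unfold_locales (auto simp: bicyclic_III_edges_def attach_def)
  show ?thesis
    using metric_dimension_G False assms by (simp add: bicyclic_III_def add.commute)
qed

theorem theorem3:
  fixes p q r :: nat and \<Gamma> :: "('a, 'b) pre_digraph"
  assumes "q \<ge> 2"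
    and "\<not> (p = 0 \<and> r = 0)"
    and "digraph_iso \<Gamma> (with_proj (bicyclic_III p q r))"
    and "r = 0 \<or> p = 0"
  shows "metric_dimension \<Gamma> = 2"
proof -
  obtain h where h: "pre_digraph.digraph_isomorphism \<Gamma> h"
    and eq: "with_proj (bicyclic_III p q r) = app_iso h \<Gamma>"
    using assms(3) by (auto simp: digraph_iso_def)
  \<comment> \<open>Well-formedness of \<open>\<Gamma>\<close> is part of
    \<open>digraph_isomorphism\<close>.\<close>
  then interpret wf_digraph \<Gamma> by (simp add: pre_digraph.digraph_isomorphism_def)
  show ?thesis
    using metric_dimension_app_iso[OF h] metric_dimension_bicyclic_III[OF assms(1,2,4)]
    by (simp add: eq)
qed

end
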